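(* There exists a completely regular nonseparable topological space with the $L$-property and with the countable chain condition.
   Context: A function $f:X\times Y\to\mathbb R$ on a product of topological spaces is separately continuous if it is continuous in each variable when the other is fixed. A function $f:Z\to\mathbb R$ on a topological space $Z$ is a first Lebesgue class function if $f^{-1}(G)$ is an $F_\sigma$-set in $Z$ (a countable union of closed sets) for every open set $G\subseteq\mathbb R$. A topological space $X$ has the $L$-property if for every topological space $Y$ each separately continuous function $f:X\times Y\to\mathbb R$ is a first Lebesgue class function on $X\times Y$ (with the product topology). A topological space $X$ has the countable chain condition if every system of pairwise disjoint open sets in $X$ is at most countable. *)

theory Defs
  imports "HOL-Analysis.Analysis"
begin

definition separately_continuous ::
    "'a topology \<Rightarrow> 'b topology \<Rightarrow> ('a \<times> 'b \<Rightarrow> real) \<Rightarrow> bool" where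
  "separately_continuous X Y f \<longleftrightarrow>
     (\<forall>y\<in>topspace Y. continuous_map X euclideanreal (\<lambda>x. f (x, y))) \<and>
     (\<forall>x\<in>topspace X. continuous_map Y euclideanreal (\<lambda>y. f (x, y)))"

definition first_Lebesgue_class :: "'c topology \<Rightarrow> ('c \<Rightarrow> real) \<Rightarrow> bool" where
  "first_Lebesgue_class Z f \<longleftrightarrow>
     (\<forall>G::real set. open G \<longrightarrow> fsigma_in Z {z \<in> topspace Z. f z \<in> G})"

definition countable_chain_condition :: "'a topology \<Rightarrow> bool" where
  "countable_chain_condition X \<longleftrightarrow>
     (\<forall>\<U>. (\<forall>U\<in>\<U>. openin X U) \<and> disjoint \<U> \<longrightarrow> countable \<U>)"

text \<open>
  The \<open>L\<close>-property quantifies over all topological spaces \<open>Y\<close>, but a formula of HOL cannot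
  quantify over the type of points of \<open>Y\<close>. In the definition \<open>Y\<close> ranges over all topologies
  on subsets of \<^typ>\<open>'a \<Rightarrow> real\<close>. No generality is lost: by the lemma \<open>L_propertyD\<close> below,
  the property then holds for a space \<open>Y\<close> over any type \<^typ>\<open>'b\<close> whatsoever, because each
  separately continuous function factors through the evaluation map on the product of \<open>X\<close>
  with the space of continuous real functions on \<open>X\<close>, topologized pointwise.
\<close>

definition L_property :: "'a topology \<Rightarrow> bool" where
  "L_property X \<longleftrightarrow>
     (\<forall>(Y :: ('a \<Rightarrow> real) topology) f.
        separately_continuous X Y f \<longrightarrow> first_Lebesgue_class (prod_topology X Y) f)"

lemma fsigma_in_continuous_map_preimage:
  assumes g: "continuous_map Z W g" and S: "fsigma_in W S"
  shows "fsigma_in Z {z \<in> topspace Z. g z \<in> S}"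
proof -
  obtain \<C> where \<C>: "countable \<C>" "\<C> \<subseteq> Collect (closedin W)" "\<Union>\<C> = S"
    using S unfolding fsigma_in_def union_of_def by blast
  have "{z \<in> topspace Z. g z \<in> S} = \<Union>((\<lambda>C. {z \<in> topspace Z. g z \<in> C}) ` \<C>)"
    using \<C>(3) by blast
  moreover have "fsigma_in Z (\<Union>((\<lambda>C. {z \<in> topspace Z. g z \<in> C}) ` \<C>))"
  proof (rule fsigma_in_Union)
    show "countable ((\<lambda>C. {z \<in> topspace Z. g z \<in> C}) ` \<C>)"
      using \<C>(1) by blast
    show "\<And>S. S \<in> (\<lambda>C. {z \<in> topspace Z. g z \<in> C}) ` \<C> \<Longrightarrow> fsigma_in Z S"
      using \<C>(2) closedin_continuous_map_preimage[OF g] closed_imp_fsigma_in by blast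
  qed
  ultimately show ?thesis by simp
qed

lemma L_propertyD:
  fixes X :: "'a topology" and Y :: "'b topology"
  assumes L: "L_property X" and f: "separately_continuous X Y f"
  shows "first_Lebesgue_class (prod_topology X Y) f"
proof -
  define T where "T = subtopology (powertop_real (topspace X))
                        {g. continuous_map X euclideanreal g}"
  define \<phi> where "\<phi> y = restrict (\<lambda>x. f (x, y)) (topspace X)" for y
  define e where "e = (\<lambda>(x::'a, g::'a \<Rightarrow> real). g x)"
  have "continuous_map T euclideanreal (\<lambda>g. g x)" if "x \<in> topspace X" for x
    unfolding T_def
    by (rule continuous_map_from_subtopology, rule continuous_map_product_projection) (rule that)
  then have "separately_continuous X T e"
    unfolding separately_continuous_def e_def by (simp add: T_def)
  then have e: "first_Lebesgue_class (prod_topology X T) e"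
    using L unfolding L_property_def by blast
  have \<phi>_cont: "continuous_map X euclideanreal (\<phi> y)" if "y \<in> topspace Y" for y
  proof (rule continuous_map_eq)
    show "continuous_map X euclideanreal (\<lambda>x. f (x, y))"
      using f that unfolding separately_continuous_def by blast
  qed (simp add: \<phi>_def)
  have "continuous_map Y (powertop_real (topspace X)) \<phi>"
    unfolding continuous_map_componentwise
  proof (intro conjI ballI)
    show "\<phi> ` topspace Y \<subseteq> extensional (topspace X)"
      by (auto simp: \<phi>_def)
    show "continuous_map Y euclideanreal (\<lambda>y. \<phi> y x)" if "x \<in> topspace X" for x
      using f that unfolding separately_continuous_def \<phi>_def by simp
  qed
  then have "continuous_map Y T \<phi>"
    unfolding T_def continuous_map_in_subtopology using \<phi>_cont by auto
  then have m: "continuous_map (prod_topology X Y) (prod_topology X T) (\<lambda>(x, y). (x, \<phi> y))"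
    by (simp add: continuous_map_prod_top[where f="\<lambda>x. x", simplified])
  show ?thesis
    unfolding first_Lebesgue_class_def
  proof (intro allI impI)
    fix G :: "real set" assume "open G"
    then have "fsigma_in (prod_topology X T) {z \<in> topspace (prod_topology X T). e z \<in> G}"
      using e unfolding first_Lebesgue_class_def by blast
    from fsigma_in_continuous_map_preimage[OF m this]
    have "fsigma_in (prod_topology X Y)
            {z \<in> topspace (prod_topology X Y). (\<lambda>(x, y). (x, \<phi> y)) z
               \<in> {z \<in> topspace (prod_topology X T). e z \<in> G}}" .
    moreover have "{z \<in> topspace (prod_topology X Y). (\<lambda>(x, y). (x, \<phi> y)) z
               \<in> {z \<in> topspace (prod_topology X T). e z \<in> G}}
        = {z \<in> topspace (prod_topology X Y). f z \<in> G}"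
      using continuous_map_image_subset_topspace[OF m]
      by (fastforce simp: e_def \<phi>_def)
    ultimately show "fsigma_in (prod_topology X Y) {z \<in> topspace (prod_topology X Y). f z \<in> G}"
      by simp
  qed
qed

end

theory Submission
  imports Defs
begin

text \<open>
  The space is the Pixley-Roy hyperspace of the real line: the finite sets of reals, where the
  basic neighbourhoods of \<open>F\<close> are the sets \<open>{H. F \<subseteq> H \<subseteq> W}\<close> with \<open>W \<supseteq> F\<close> open. These are clopen.
  A dense family of finite sets must cover the line, so it is uncountable. If \<open>F\<close> and \<open>F'\<close> have
  the same \<open>W\<close>, then \<open>F \<union> F'\<close> is in both basic neighbourhoods; as \<open>W\<close> can be taken from a
  countable family, this gives the countable chain condition. Finally, the finite sets whose
  points are at distance at least \<open>1 / n\<close> from each other form a closed discrete set, and on a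
  countable union of closed discrete sets continuity in the second variable alone makes a
  function first Lebesgue class.
\<close>

text \<open>Each point of \<open>X\<close> has a neighbourhood meeting \<open>D n\<close> in at most
  that point. So over \<open>D n\<close>, closedness in the product is checked one fibre
  \<open>{x} \<times> Y\<close> at a time.\<close>

lemma first_Lebesgue_class_sigma_closed_discrete:
  fixes X :: "'a topology" and Y :: "'b topology" and D :: "nat \<Rightarrow> 'a set"
  assumes D: "\<And>n. X derived_set_of D n = {}" "topspace X \<subseteq> (\<Union>n. D n)"
    and f: "\<And>x. x \<in> topspace X \<Longrightarrow> continuous_map Y euclideanreal (\<lambda>y. f (x, y))"
  shows "first_Lebesgue_class (prod_topology X Y) f"
  unfolding first_Lebesgue_class_def
proof (intro allI impI)
  fix G :: "real set" assume "open G"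
  then have "fsigma_in euclideanreal G"
    by (simp add: metrizable_space_euclidean open_imp_fsigma_in)
  then obtain \<C> where \<C>: "countable \<C>" "\<C> \<subseteq> Collect (closedin euclideanreal)" "\<Union>\<C> = G"
    unfolding fsigma_in_def union_of_def by blast
  let ?Z = "prod_topology X Y"
  \<comment> \<open>The open set \<open>G\<close> is a countable union of closed sets
    \<open>C\<close>; the pieces \<open>E n C\<close> of their preimages over \<open>D n\<close>
    will be the closed sets whose union is the preimage of \<open>G\<close>.\<close>
  define E where "E n C = {z \<in> topspace ?Z. fst z \<in> D n \<and> f z \<in> C}" for n C
  have closedE: "closedin ?Z (E n C)" if "C \<in> \<C>" for n C
    unfolding closedin_def
  proof (intro conjI)
    show "E n C \<subseteq> topspace ?Z"
      by (auto simp: E_def)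
    show "openin ?Z (topspace ?Z - E n C)"
      unfolding openin_prod_topology_alt
    proof (intro allI impI)
      fix x y assume xy: "(x, y) \<in> topspace ?Z - E n C"
      then have x: "x \<in> topspace X" and y: "y \<in> topspace Y"
        by auto
      have "x \<notin> X derived_set_of D n"
        by (simp add: D(1))
      then obtain U where U: "openin X U" "x \<in> U" "U \<inter> D n \<subseteq> {x}"
        using x unfolding derived_set_of_def by auto
      \<comment> \<open>Over \<open>U\<close> the set \<open>E n C\<close> can only have points in
        the fibre of \<open>x\<close>. If \<open>x \<in> D n\<close>, continuity of \<open>f\<close>
        on that fibre gives \<open>V\<close>; otherwise \<open>U\<close> misses \<open>D n\<close>
        and all of \<open>Y\<close> will do.\<close>
      define V where "V = (if x \<in> D n then {y \<in> topspace Y. f (x, y) \<in> - C} else topspace Y)"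
      have "openin euclideanreal (- C)"
        using \<C>(2) that by (auto simp: closed_def)
      then have "openin Y V"
        using openin_continuous_map_preimage[OF f[OF x], of "- C"] unfolding V_def by simp
      moreover have "U \<times> V \<subseteq> topspace ?Z - E n C"
        using U openin_subset[OF U(1)] by (auto simp: E_def V_def split: if_splits)
      moreover have "y \<in> V"
        using xy x y by (auto simp: V_def E_def)
      ultimately show "\<exists>U V. openin X U \<and> openin Y V \<and> x \<in> U \<and> y \<in> V \<and> U \<times> V \<subseteq> topspace ?Z - E n C"
        using U(1,2) by (intro exI[of _ U] exI[of _ V]) simp
    qed
  qed
  have "\<exists>n. fst z \<in> D n" if "z \<in> topspace ?Z" for z
    using subsetD[OF D(2), of "fst z"] that by (auto simp: mem_Times_iff)
  then have "{z \<in> topspace ?Z. f z \<in> G} = (\<Union>(n, C) \<in> UNIV \<times> \<C>. E n C)"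
    unfolding E_def \<C>(3)[symmetric] by blast
  moreover have "fsigma_in ?Z (\<Union>(n, C) \<in> UNIV \<times> \<C>. E n C)"
  proof (rule fsigma_in_Union)
    show "countable ((\<lambda>(n, C). E n C) ` (UNIV \<times> \<C>))"
      using \<C>(1) by simp
    show "fsigma_in ?Z S" if "S \<in> (\<lambda>(n, C). E n C) ` (UNIV \<times> \<C>)" for S
      using that closedE by (auto intro: closed_imp_fsigma_in)
  qed
  ultimately show "fsigma_in ?Z {z \<in> topspace ?Z. f z \<in> G}"
    by simp
qed

section \<open>The Pixley-Roy topology and its separation properties\<close>

definition pixley_roy_nhd :: "'a set \<Rightarrow> 'a set \<Rightarrow> 'a set set" where
  "pixley_roy_nhd F W = {H. finite H \<and> F \<subseteq> H \<and> H \<subseteq> W}"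

text \<open>The conjunct \<open>finite F\<close> confines open families to finite sets and thereby
  determines the \<open>topspace\<close>.\<close>

definition pixley_roy :: "'a::topological_space set topology" where
  "pixley_roy = topology (\<lambda>\<O>. \<forall>F\<in>\<O>. finite F \<and> (\<exists>W. open W \<and> F \<subseteq> W \<and> pixley_roy_nhd F W \<subseteq> \<O>))"

text \<open>\<open>topology\<close> can be unfolded only once \<open>istopology\<close> is verified.
  Binary intersections work because \<open>pixley_roy_nhd F W\<close> is monotone in
  \<open>W\<close>.\<close>

lemma openin_pixley_roy:
  fixes \<O> :: "'a::topological_space set set"
  shows "openin pixley_roy \<O> \<longleftrightarrow>
     (\<forall>F\<in>\<O>. finite F \<and> (\<exists>W. open W \<and> F \<subseteq> W \<and> pixley_roy_nhd F W \<subseteq> \<O>))"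
proof -
  have "istopology (\<lambda>\<O> :: 'a set set. \<forall>F\<in>\<O>. finite F \<and> (\<exists>W. open W \<and> F \<subseteq> W \<and> pixley_roy_nhd F W \<subseteq> \<O>))"
    unfolding istopology_def
  proof (intro conjI allI impI ballI)
    fix S T :: "'a set set" and F :: "'a set"
    assume S: "\<forall>F\<in>S. finite F \<and> (\<exists>W. open W \<and> F \<subseteq> W \<and> pixley_roy_nhd F W \<subseteq> S)"
      and T: "\<forall>F\<in>T. finite F \<and> (\<exists>W. open W \<and> F \<subseteq> W \<and> pixley_roy_nhd F W \<subseteq> T)"
      and F: "F \<in> S \<inter> T"
    show "finite F"
      using S F by simp
    obtain V where V: "open V" "F \<subseteq> V" "pixley_roy_nhd F V \<subseteq> S"
      using S F by auto
    obtain W where W: "open W" "F \<subseteq> W" "pixley_roy_nhd F W \<subseteq> T"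
      using T F by auto
    have "pixley_roy_nhd F (V \<inter> W) \<subseteq> pixley_roy_nhd F V \<inter> pixley_roy_nhd F W"
      by (auto simp: pixley_roy_nhd_def)
    then have "pixley_roy_nhd F (V \<inter> W) \<subseteq> S \<inter> T"
      using V(3) W(3) by blast
    then show "\<exists>W. open W \<and> F \<subseteq> W \<and> pixley_roy_nhd F W \<subseteq> S \<inter> T"
      using open_Int[OF V(1) W(1)] V(2) W(2) by (metis Int_greatest)
  next
    fix \<K> :: "'a set set set" and F :: "'a set"
    assume \<K>: "\<forall>S\<in>\<K>. \<forall>F\<in>S. finite F \<and> (\<exists>W. open W \<and> F \<subseteq> W \<and> pixley_roy_nhd F W \<subseteq> S)"
      and "F \<in> \<Union>\<K>"
    then obtain S where S: "S \<in> \<K>" "F \<in> S"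
      by blast
    with \<K> show "finite F"
      by blast
    obtain W where "open W" "F \<subseteq> W" "pixley_roy_nhd F W \<subseteq> S"
      using bspec[OF bspec[OF \<K> S(1)] S(2)] by auto
    moreover have "S \<subseteq> \<Union>\<K>"
      using S(1) by (rule Union_upper)
    ultimately show "\<exists>W. open W \<and> F \<subseteq> W \<and> pixley_roy_nhd F W \<subseteq> \<Union>\<K>"
      by (metis order_trans)
  qed
  from topology_inverse'[OF this] show ?thesis
    unfolding pixley_roy_def by (rule fun_cong)
qed

lemma topspace_pixley_roy [simp]: "topspace pixley_roy = {F. finite F}"
proof -
  have "openin pixley_roy {F :: 'a set. finite F}"
    unfolding openin_pixley_roy by (auto simp: pixley_roy_nhd_def)
  moreover have "topspace pixley_roy \<subseteq> {F :: 'a set. finite F}"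
    using openin_topspace[of pixley_roy] unfolding openin_pixley_roy by blast
  ultimately show ?thesis
    using openin_subset by blast
qed

text \<open>The same \<open>W\<close> serves for every member \<open>H\<close>, since
  \<open>pixley_roy_nhd H W \<subseteq> pixley_roy_nhd F W\<close>.\<close>

lemma openin_pixley_roy_nhd: "open W \<Longrightarrow> openin pixley_roy (pixley_roy_nhd F W)"
  unfolding openin_pixley_roy by (auto simp: pixley_roy_nhd_def)

text \<open>A finite \<open>H\<close> outside the family either has a point outside
  \<open>W\<close>, which all its supersets keep, or misses some \<open>x \<in> F\<close>, and then
  so does every subset of the open set \<open>- {x}\<close>. Since \<open>W\<close> is arbitrary,
  this also covers \<open>pixley_roy_nhd F F\<close>, a singleton for finite
  \<open>F\<close>.\<close>

lemma closedin_pixley_roy_nhd: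
  fixes W :: "'a::t1_space set"
  shows "closedin pixley_roy (pixley_roy_nhd F W)"
  unfolding closedin_def openin_pixley_roy
proof (intro conjI ballI)
  fix H assume H: "H \<in> topspace pixley_roy - pixley_roy_nhd F W"
  then show "finite H"
    by simp
  show "\<exists>V. open V \<and> H \<subseteq> V \<and> pixley_roy_nhd H V \<subseteq> topspace pixley_roy - pixley_roy_nhd F W"
  proof (cases "F \<subseteq> H")
    case True
    then have "\<not> H \<subseteq> W"
      using H by (auto simp: pixley_roy_nhd_def)
    then show ?thesis
      by (intro exI[of _ UNIV]) (auto simp: pixley_roy_nhd_def)
  next
    case False
    then obtain x where "x \<in> F" "x \<notin> H"
      by blast
    then show ?thesis
      by (intro exI[of _ "- {x}"]) (auto simp: pixley_roy_nhd_def)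
  qed
qed (auto simp: pixley_roy_nhd_def)

lemma completely_regular_space_pixley_roy:
  "completely_regular_space (pixley_roy :: 'a::t1_space set topology)"
proof -
  have "(pixley_roy :: 'a set topology) dim_le 0"
    unfolding dimension_le_0_neighbourhood_base_of_clopen
  proof (subst open_neighbourhood_base_of, blast, intro allI impI)
    fix \<O> :: "'a set set" and F assume "openin pixley_roy \<O> \<and> F \<in> \<O>"
    then obtain W where "finite F" "open W" "F \<subseteq> W" "pixley_roy_nhd F W \<subseteq> \<O>"
      unfolding openin_pixley_roy by blast
    then show "\<exists>U. (closedin pixley_roy U \<and> openin pixley_roy U) \<and> F \<in> U \<and> U \<subseteq> \<O>"
      by (intro exI[of _ "pixley_roy_nhd F W"])
        (auto simp: closedin_pixley_roy_nhd openin_pixley_roy_nhd, simp add: pixley_roy_nhd_def)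
  qed
  then show ?thesis
    by (rule zero_dimensional_imp_completely_regular_space)
qed

text \<open>\<open>completely_regular_space\<close> includes no separation axiom; together with this
  lemma the space is Tychonoff.\<close>

lemma t1_space_pixley_roy: "t1_space (pixley_roy :: 'a::t1_space set topology)"
  unfolding t1_space_closedin_singleton
proof
  fix F :: "'a set" assume "F \<in> topspace pixley_roy"
  then have "pixley_roy_nhd F F = {F}"
    by (auto simp: pixley_roy_nhd_def)
  then show "closedin pixley_roy {F}"
    by (metis closedin_pixley_roy_nhd)
qed

section \<open>Nonseparability and the countable chain condition\<close>

lemma not_separable_space_pixley_roy:
  assumes "uncountable (UNIV :: 'a::topological_space set)"
  shows "\<not> separable_space (pixley_roy :: 'a set topology)"
proof
  assume "separable_space (pixley_roy :: 'a set topology)"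
  then obtain \<C> :: "'a set set" where \<C>: "countable \<C>" "\<C> \<subseteq> {F. finite F}"
    and dense: "pixley_roy closure_of \<C> = {F. finite F}"
    unfolding separable_space_def by auto
  have "countable (\<Union>\<C>)"
    using \<C> countable_UN[of \<C> "\<lambda>F. F"] by (auto intro: countable_finite)
  then obtain x where x: "x \<notin> \<Union>\<C>"
    using assms by (metis UNIV_eq_I)
  have "{x} \<in> pixley_roy closure_of \<C>"
    by (simp add: dense)
  moreover have "{x} \<in> pixley_roy_nhd {x} UNIV"
    by (simp add: pixley_roy_nhd_def)
  ultimately have "\<exists>F\<in>\<C>. F \<in> pixley_roy_nhd {x} UNIV"
    using openin_pixley_roy_nhd[OF open_UNIV] unfolding in_closure_of by blast
  with x show False
    by (auto simp: pixley_roy_nhd_def)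
qed

lemma countable_chain_condition_pixley_roy:
  "countable_chain_condition (pixley_roy :: 'a::second_countable_topology set topology)"
  unfolding countable_chain_condition_def
proof (intro allI impI, elim conjE)
  fix \<U> :: "'a set set set"
  assume op: "\<forall>U\<in>\<U>. openin pixley_roy U" and disj: "disjoint \<U>"
  obtain B :: "'a set set" where B: "countable B" "topological_basis B"
    using ex_countable_basis by blast
  \<comment> \<open>A finite subset of an open \<open>V\<close> is covered by finitely many basis
    elements inside \<open>V\<close>, so countably many \<open>W\<close> suffice.\<close>
  define \<W> where "\<W> = Union ` {\<G>. finite \<G> \<and> \<G> \<subseteq> B}"
  have "countable \<W>"
    unfolding \<W>_def using B(1) by (intro countable_image countable_Collect_finite_subset)
  \<comment> \<open>The empty set is removed because a basic neighbourhood is chosen around a member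
    of \<open>U\<close>; it adds at most one element to \<open>\<U>\<close>.\<close>
  have "\<exists>F W. finite F \<and> F \<subseteq> W \<and> W \<in> \<W> \<and> pixley_roy_nhd F W \<subseteq> U"
    if U: "U \<in> \<U> - {{}}" for U
  proof -
    obtain F where "F \<in> U" and "openin pixley_roy U"
      using op U by auto
    then obtain V where F: "finite F" and V: "open V" "F \<subseteq> V" "pixley_roy_nhd F V \<subseteq> U"
      by (auto simp: openin_pixley_roy)
    have "\<exists>b\<in>B. x \<in> b \<and> b \<subseteq> V" if "x \<in> F" for x
      by (meson topological_basisE[OF B(2) V(1)] that V(2) subsetD)
    then obtain b where b: "\<And>x. x \<in> F \<Longrightarrow> b x \<in> B \<and> x \<in> b x \<and> b x \<subseteq> V"
      by metis
    then have "b ` F \<in> {\<G>. finite \<G> \<and> \<G> \<subseteq> B}"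
      using F by auto
    then have "\<Union>(b ` F) \<in> \<W>"
      unfolding \<W>_def by (rule imageI)
    moreover have "F \<subseteq> \<Union>(b ` F)" "\<Union>(b ` F) \<subseteq> V"
      using b by blast+
    moreover have "pixley_roy_nhd F (\<Union>(b ` F)) \<subseteq> pixley_roy_nhd F V"
      using calculation(3) unfolding pixley_roy_nhd_def by blast
    ultimately show ?thesis
      using F V(3) by (intro exI[of _ F] exI[of _ "\<Union>(b ` F)"]) simp
  qed
  then obtain F W where FW: "\<And>U. U \<in> \<U> - {{}} \<Longrightarrow>
      finite (F U) \<and> F U \<subseteq> W U \<and> W U \<in> \<W> \<and> pixley_roy_nhd (F U) (W U) \<subseteq> U"
    by metis
  have "inj_on W (\<U> - {{}})"
  proof (rule inj_onI)
    fix U U' assume U: "U \<in> \<U> - {{}}" and U': "U' \<in> \<U> - {{}}" and eq: "W U = W U'"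
    have "F U \<union> F U' \<in> pixley_roy_nhd (F U) (W U) \<inter> pixley_roy_nhd (F U') (W U')"
      using FW[OF U] FW[OF U'] eq by (simp add: pixley_roy_nhd_def)
    then have "U \<inter> U' \<noteq> {}"
      using FW[OF U] FW[OF U'] by blast
    then show "U = U'"
      using disj U U' unfolding disjoint_def by blast
  qed
  moreover have "W ` (\<U> - {{}}) \<subseteq> \<W>"
    using FW by blast
  ultimately have "countable (\<U> - {{}})"
    using \<open>countable \<W>\<close> by (metis countable_subset countable_image_inj_on)
  then show "countable \<U>"
    by simp
qed

section \<open>Closed discrete pieces and the \<open>L\<close>-property\<close>

lemma derived_set_of_pixley_roy_separated:
  fixes e :: real
  assumes "e > 0"
  shows "pixley_roy derived_set_of {F :: 'a::metric_space set. \<forall>x\<in>F. \<forall>y\<in>F. dist x y < e \<longrightarrow> x = y} = {}"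
    (is "_ derived_set_of ?D = _")
proof -
  have "\<exists>T. H \<in> T \<and> openin pixley_roy T \<and> (\<forall>F\<in>T. F \<in> ?D \<longrightarrow> F = H)" if "finite H" for H :: "'a set"
  proof (intro exI conjI ballI impI)
    \<comment> \<open>A separated \<open>F\<close> with
      \<open>H \<subseteq> F \<subseteq> ?W\<close> equals \<open>H\<close>: each
      \<open>x \<in> F\<close> is closer than \<open>e\<close> to some \<open>h \<in> H\<close>,
      which also lies in \<open>F\<close>, so \<open>x = h\<close>.\<close>
    let ?W = "\<Union>x\<in>H. ball x e"
    show "H \<in> pixley_roy_nhd H ?W"
      unfolding pixley_roy_nhd_def using that assms centre_in_ball by blast
    show "openin pixley_roy (pixley_roy_nhd H ?W)"
      by (intro openin_pixley_roy_nhd) auto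
    fix F assume F: "F \<in> pixley_roy_nhd H ?W" and D: "F \<in> ?D"
    have "x \<in> H" if x: "x \<in> F" for x
    proof -
      have "x \<in> ?W"
        using F x unfolding pixley_roy_nhd_def by blast
      then obtain h where h: "h \<in> H" "dist h x < e"
        by auto
      moreover have "h \<in> F"
        using F h(1) unfolding pixley_roy_nhd_def by blast
      ultimately show ?thesis
        using D x by blast
    qed
    then show "F = H"
      using F unfolding pixley_roy_nhd_def by blast
  qed
  then have "H \<notin> pixley_roy derived_set_of ?D" for H
    unfolding derived_set_of_def topspace_pixley_roy mem_Collect_eq by metis
  then show ?thesis
    by (simp add: set_eq_iff)
qed

lemma L_property_pixley_roy: "L_property (pixley_roy :: 'a::heine_borel set topology)"
  unfolding L_property_def
proof (intro allI impI)
  fix Y :: "('a set \<Rightarrow> real) topology" and f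
  assume f: "separately_continuous (pixley_roy :: 'a set topology) Y f"
  \<comment> \<open>\<open>Suc n\<close> keeps the bound positive; with \<open>inverse 0 = 0\<close>
    the first piece would contain every set.\<close>
  define D where
    "D n = {F :: 'a set. \<forall>x\<in>F. \<forall>y\<in>F. dist x y < inverse (real (Suc n)) \<longrightarrow> x = y}" for n
  show "first_Lebesgue_class (prod_topology pixley_roy Y) f"
  proof (rule first_Lebesgue_class_sigma_closed_discrete[where D = D])
    show "pixley_roy derived_set_of D n = {}" for n
      unfolding D_def by (rule derived_set_of_pixley_roy_separated) simp
    show "topspace pixley_roy \<subseteq> (\<Union>n. D n)"
    proof
      fix F :: "'a set" assume "F \<in> topspace pixley_roy"
      \<comment> \<open>Distinct points of a finite set have a positive minimal distance, so some
        \<open>D n\<close> contains \<open>F\<close>.\<close>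
      then obtain e where e: "e > 0" "\<forall>x\<in>F. \<forall>y\<in>F. dist x y < e \<longrightarrow> x = y"
        using uniform_discrete_finite_iff[of F] by (auto simp: uniform_discrete_def)
      obtain n where "inverse (real (Suc n)) < e"
        using reals_Archimedean[OF e(1)] by blast
      then have "F \<in> D n"
        using e(2) unfolding D_def by (blast intro: less_trans)
      then show "F \<in> (\<Union>n. D n)"
        by blast
    qed
    show "continuous_map Y euclideanreal (\<lambda>y. f (F, y))" if "F \<in> topspace pixley_roy" for F
      using f that unfolding separately_continuous_def by blast
  qed
qed

theorem theorem3p3:
  shows "\<exists>X :: real set topology.
           completely_regular_space X \<and> t1_space X \<and> \<not> separable_space X \<and>
           L_property X \<and> countable_chain_condition X"
  \<comment> \<open>The type \<open>real\<close> meets all the sort constraints at once: it is T1,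
    second countable and Heine-Borel; its uncountability gives nonseparability.\<close>
  using completely_regular_space_pixley_roy t1_space_pixley_roy L_property_pixley_roy
    not_separable_space_pixley_roy[OF uncountable_UNIV_real] countable_chain_condition_pixley_roy
  by blast

end
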